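(* Let $c\in\mathbb{C}$, $q(x)=x^2+c$, and let $\Lambda$ be a compact invariant subset of the Julia set $J(q)$. Let $H_0:\mathbb{C}^2\to\mathbb{C}^2$, $H_0(x,y)=(x^2+c,x)$, let $g:\mathbb{C}\to\mathbb{C}^2$, $g(x)=(q(x),x)$, and let $\mathcal{A}:=g(\Lambda)=\{(q(x),x): x\in\Lambda\}$. Then: (i) $\mathcal{A}$ is an invariant set of the restriction $H_0|_{\mathcal{A}}$ of $H_0$ to $\mathcal{A}$, i.e. $(H_0|_{\mathcal{A}})^{-1}(\mathcal{A})=\mathcal{A}$. (ii) $g$ is a topological conjugacy between $\Lambda$ and $\mathcal{A}$, i.e. $g|_\Lambda:\Lambda\to\mathcal{A}$ is a homeomorphism and $H_0\circ g=g\circ q$ on $\Lambda$, where $q$ is regarded as a map $\Lambda\to\Lambda$ and $H_0$ as a map $\mathcal{A}\to\mathcal{A}$.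
   Context: A set $S$ is called invariant under a map $f$ if $f^{-1}(S)=S$. For $q(x)=x^2+c$, $K(q)$ is the set of points of $\mathbb{C}$ with bounded forward orbit under $q$, and the Julia set $J(q)$ is the boundary of $K(q)$ in $\mathbb{C}$. *)

theory Defs
  imports "HOL-Analysis.Analysis"
begin

definition quad :: "complex \<Rightarrow> complex \<Rightarrow> complex" where
  "quad c x = x\<^sup>2 + c"

definition filled_julia :: "(complex \<Rightarrow> complex) \<Rightarrow> complex set" where
  "filled_julia f = {z. bounded (range (\<lambda>n. (f ^^ n) z))}"

definition julia :: "(complex \<Rightarrow> complex) \<Rightarrow> complex set" where
  "julia f = frontier (filled_julia f)"

(* A map with domain D is a total function considered on D only, so the preimage of S
   under it is taken inside D.  For D = UNIV this is full invariance under f; taking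
   D = S gives invariance of S under the restriction of f to S. *)
definition invariant_on :: "('a \<Rightarrow> 'a) \<Rightarrow> 'a set \<Rightarrow> 'a set \<Rightarrow> bool" where
  "invariant_on f D S \<longleftrightarrow> f -` S \<inter> D = S"

definition H0 :: "complex \<Rightarrow> complex \<times> complex \<Rightarrow> complex \<times> complex" where
  "H0 c = (\<lambda>(x, y). (x\<^sup>2 + c, x))"

definition gmap :: "complex \<Rightarrow> complex \<Rightarrow> complex \<times> complex" where
  "gmap c x = (quad c x, x)"

(* h conjugates f, regarded as a map from S to S, to F, regarded as a map from T to T. *)
definition topological_conjugacy ::
  "('a::topological_space \<Rightarrow> 'b::topological_space) \<Rightarrow> 'a set \<Rightarrow> ('a \<Rightarrow> 'a) \<Rightarrow>
    'b set \<Rightarrow> ('b \<Rightarrow> 'b) \<Rightarrow> bool" where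
  "topological_conjugacy h S f T F \<longleftrightarrow>
     f ` S \<subseteq> S \<and> F ` T \<subseteq> T \<and> (\<exists>k. homeomorphism S T h k) \<and>
     (\<forall>x\<in>S. F (h x) = h (f x))"

end

theory Submission
  imports Defs
begin

text \<open>The graph map \<^term>\<open>gmap c\<close> records a point together with its image, as a pair
  (present, past); \<^term>\<open>H0 c\<close> reads only the present coordinate, computes the next iterate and
  shifts. Hence it acts on the graph exactly as \<^term>\<open>quad c\<close> acts on the base
  (\<open>H0_gmap\<close>). A graph map of a continuous function is a homeomorphism onto
  its image, because the second projection undoes it (\<open>homeomorphism_gmap\<close>). The
  conjugacy follows, and the forward invariance of \<open>\<Lambda>\<close> is transported to \<open>\<A>\<close>, which for a map
  restricted to \<open>\<A>\<close> already gives \<open>\<A>\<close> as the full preimage of itself.\<close>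

lemma H0_gmap: "H0 c (gmap c x) = gmap c (quad c x)"
  by (simp add: H0_def gmap_def quad_def)

lemma homeomorphism_gmap: "homeomorphism S (gmap c ` S) (gmap c) snd"
proof (rule homeomorphismI)
  show "continuous_on S (gmap c)"
    unfolding gmap_def quad_def by (intro continuous_intros)
  show "continuous_on (gmap c ` S) snd"
    by (intro continuous_intros)
qed (auto simp: gmap_def)

theorem proposition1p2:
  fixes c :: complex and \<Lambda> :: "complex set" and \<A> :: "(complex \<times> complex) set"
  assumes "compact \<Lambda>"
    and "\<Lambda> \<subseteq> julia (quad c)"
    and "invariant_on (quad c) UNIV \<Lambda>"
  defines "\<A> \<equiv> gmap c ` \<Lambda>"
  shows "invariant_on (H0 c) \<A> \<A> \<and>
    topological_conjugacy (gmap c) \<Lambda> (quad c) \<A> (H0 c)"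
proof -
  have q: "quad c ` \<Lambda> \<subseteq> \<Lambda>"
    using assms(3) by (auto simp: invariant_on_def)
  then have H: "H0 c ` \<A> \<subseteq> \<A>"
    by (auto simp: \<A>_def H0_gmap)
  then have "invariant_on (H0 c) \<A> \<A>"
    by (auto simp: invariant_on_def)
  moreover have "topological_conjugacy (gmap c) \<Lambda> (quad c) \<A> (H0 c)"
    using q H homeomorphism_gmap[of \<Lambda> c]
    by (auto simp: topological_conjugacy_def H0_gmap \<A>_def)
  ultimately show ?thesis ..
qed

end
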